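(* Let $A$ be an infinite set of nonnegative integers, let $d\ge 0$ be an integer and let $\lambda_0,\dots,\lambda_d$ be integers with $\sum_{i=0}^{d}|\lambda_i|>0$; write $\underline{\lambda}=(\lambda_0,\dots,\lambda_d)$. Then \[ \limsup_{n \to \infty}\left|\sum_{i=0}^{d}\lambda_{i}R_{A}(n - i)\right| \ge \limsup_{n \to \infty}\frac{|\sum_{i=0}^{d}\lambda_{i}|}{2(d+1)^{2}}\left(\frac{B(A, \underline{\lambda}, n)}{\sqrt{n}}\right)^{2}. \]
   Context: For a set $A$ of nonnegative integers and an integer $n$, $R_A(n)$ denotes the number of ordered pairs $(a,a')\in A\times A$ with $a+a'=n$ (so $R_A(n)=0$ for $n<0$). $\chi_A$ is the characteristic function of $A$ on the integers ($\chi_A(m)=1$ if $m\in A$, $0$ otherwise; in particular $\chi_A(m)=0$ for $m<0$). For $\underline{\lambda}=(\lambda_0,\dots,\lambda_d)$ define $B(A,\underline{\lambda},n)=\#\{m\in\mathbb{Z}_{\ge 0}: m\le n,\ \sum_{i=0}^{d}\lambda_i\chi_A(m-i)\neq 0\}$. Limsups may equal $+\infty$. *)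

theory Defs
  imports "HOL-Analysis.Analysis"
begin

definition rep_count :: "nat set \<Rightarrow> int \<Rightarrow> nat" where
  "rep_count A n = card {(a, a'). a \<in> A \<and> a' \<in> A \<and> int a + int a' = n}"

definition char_fun :: "nat set \<Rightarrow> int \<Rightarrow> int" where
  "char_fun A m = (if m \<in> int ` A then 1 else 0)"

(* Only the values lam 0, ..., lam d of the coefficient function matter. *)
definition B_count :: "nat set \<Rightarrow> nat \<Rightarrow> (nat \<Rightarrow> int) \<Rightarrow> nat \<Rightarrow> nat" where
  "B_count A d lam n =
     card {m::nat. m \<le> n \<and> (\<Sum>i=0..d. lam i * char_fun A (int m - int i)) \<noteq> 0}"

end

theory Submission
  imports Defs "HOL-Real_Asymp.Real_Asymp"
begin

text \<open>
  Let $D_n = \sum_i \lambda_i R_A(n-i)$, let $a(N)$ be the number of elements of $A$ up to $N$, and let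
  $S(N) = \sum_{n \le N} R_A(n)$. Summing $D_n$ up to $M$ gives $(\sum_i \lambda_i) S(M)$ up to an
  error $O(a(M))$, because $R_A(n) \le a(n)$. If $|D_n| \le K$ for large $n$, then
  $|\sum_i \lambda_i|\, S(M) \le K M + O(1 + a(M))$. As $a(N)^2 \le S(2N)$, the trivial bound
  $a(M) \le M + 1$ first yields $a(N) = O(\sqrt N)$, so that the error is in fact $o(M)$; with
  $B(A, \lambda, N) \le (d+1)\, a(N)$ the same inequality at $M = 2N$ then gives the claim.
\<close>

definition count_upto :: "nat set \<Rightarrow> nat \<Rightarrow> nat" where
  "count_upto A n = card (A \<inter> {..n})"

definition rep_sum :: "nat set \<Rightarrow> nat \<Rightarrow> nat" where
  "rep_sum A n = (\<Sum>k\<le>n. rep_count A (int k))"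

lemma count_upto_le: "count_upto A n \<le> n + 1"
proof -
  have "card (A \<inter> {..n}) \<le> card {..n}" by (intro card_mono) auto
  then show ?thesis by (simp add: count_upto_def)
qed

lemma rep_count_neg: "m < 0 \<Longrightarrow> rep_count A m = 0"
  by (auto simp: rep_count_def card_eq_0_iff)

lemma finite_rep_set: "finite {(a, a'). a \<in> A \<and> a' \<in> A \<and> int a + int a' = m}"
  by (rule finite_subset[of _ "{..nat m} \<times> {..nat m}"]) auto

text \<open>A pair with prescribed sum is determined by its first entry, which is at most
  \<open>m\<close>. Decoupling \<open>n\<close> from \<open>m\<close> lets one count at
  \<open>n\<close> bound all shifted values \<open>int n - int i\<close>, negative ones
  included.\<close>

lemma rep_count_le:
  assumes "m \<le> int n"
  shows "rep_count A m \<le> count_upto A n"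
  unfolding rep_count_def count_upto_def
proof (rule card_inj_on_le)
  show "inj_on fst {(a, a'). a \<in> A \<and> a' \<in> A \<and> int a + int a' = m}"
    by (auto simp: inj_on_def)
  show "fst ` {(a, a'). a \<in> A \<and> a' \<in> A \<and> int a + int a' = m} \<subseteq> A \<inter> {..n}"
    using assms by auto
qed simp

text \<open>Two elements of \<open>A\<close> up to \<open>n\<close> have a sum at most
  \<open>2 * n\<close>, so each such pair is counted by some \<open>rep_count A (int k)\<close> with
  \<open>k \<le> 2 * n\<close>.\<close>

lemma count_upto_square_le: "(count_upto A n)\<^sup>2 \<le> rep_sum A (2 * n)"
proof -
  define P where "P k = {(a, a'). a \<in> A \<and> a' \<in> A \<and> int a + int a' = int k}" for k
  have fin: "finite (P k)" for k unfolding P_def by (rule finite_rep_set)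
  have "(count_upto A n)\<^sup>2 = card ((A \<inter> {..n}) \<times> (A \<inter> {..n}))"
    by (simp add: count_upto_def card_cartesian_product power2_eq_square)
  also have "\<dots> \<le> card (\<Union>k\<in>{..2*n}. P k)"
    by (intro card_mono) (auto simp: fin, auto simp: P_def simp flip: of_nat_add)
  also have "\<dots> \<le> (\<Sum>k\<le>2*n. card (P k))"
    by (rule card_UN_le) simp
  finally show ?thesis by (simp add: rep_sum_def rep_count_def P_def)
qed

text \<open>Moving the window down by one drops its top value; the value that enters at the bottom
  has a negative argument and vanishes.\<close>

lemma sum_rep_count_shift_Suc:
  "(\<Sum>k\<le>n. rep_count A (int k - int i))
     = (\<Sum>k\<le>n. rep_count A (int k - int (Suc i))) + rep_count A (int n - int i)"
  by (induction n) (auto simp: rep_count_neg algebra_simps)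

lemma sum_rep_count_shift:
  "\<bar>int (rep_sum A n) - (\<Sum>k\<le>n. int (rep_count A (int k - int i)))\<bar> \<le> int (i * count_upto A n)"
proof -
  \<comment> \<open>Shifting only loses terms, at most \<open>count_upto A n\<close> per unit. The
    induction keeps both one-sided bounds over the naturals, free of absolute values.\<close>
  have "rep_sum A n \<le> (\<Sum>k\<le>n. rep_count A (int k - int i)) + i * count_upto A n
      \<and> (\<Sum>k\<le>n. rep_count A (int k - int i)) \<le> rep_sum A n"
  proof (induction i)
    case 0
    then show ?case by (simp add: rep_sum_def)
  next
    case (Suc i)
    have "rep_count A (int n - int i) \<le> count_upto A n" by (rule rep_count_le) simp
    with Suc sum_rep_count_shift_Suc[of A i n] show ?case by (simp del: of_nat_Suc)
  qed
  then show ?thesis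
    unfolding of_nat_sum[symmetric] by linarith
qed

text \<open>A nonzero sum forces \<open>m - i\<close> into \<open>A\<close> for some
  \<open>i \<le> d\<close>, so every counted \<open>m\<close> lies in one of \<open>d + 1\<close>
  translates of \<open>A \<inter> {..n}\<close>.\<close>

lemma B_count_le: "B_count A d lam n \<le> (d + 1) * count_upto A n"
proof -
  have "{m. m \<le> n \<and> (\<Sum>i=0..d. lam i * char_fun A (int m - int i)) \<noteq> 0}
      \<subseteq> (\<Union>i\<in>{..d}. (\<lambda>x. x + i) ` (A \<inter> {..n}))"
  proof
    fix m assume "m \<in> {m. m \<le> n \<and> (\<Sum>i=0..d. lam i * char_fun A (int m - int i)) \<noteq> 0}"
    then have m: "m \<le> n" "(\<Sum>i=0..d. lam i * char_fun A (int m - int i)) \<noteq> 0" by auto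
    from m(2) obtain i where i: "i \<le> d" "char_fun A (int m - int i) \<noteq> 0"
      by (metis (no_types, lifting) atLeastAtMost_iff mult_zero_right sum.neutral)
    then obtain x where "x \<in> A" "int m - int i = int x"
      by (auto simp: char_fun_def split: if_splits)
    with i(1) m(1) show "m \<in> (\<Union>i\<in>{..d}. (\<lambda>x. x + i) ` (A \<inter> {..n}))"
      by (intro UN_I[of i] image_eqI[of _ _ x]) auto
  qed
  then have "B_count A d lam n \<le> card (\<Union>i\<in>{..d}. (\<lambda>x. x + i) ` (A \<inter> {..n}))"
    unfolding B_count_def by (intro card_mono) auto
  also have "\<dots> \<le> (\<Sum>i\<le>d. card ((\<lambda>x. x + i) ` (A \<inter> {..n})))"
    by (rule card_UN_le) simp
  also have "\<dots> \<le> (\<Sum>i\<le>d. count_upto A n)"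
    unfolding count_upto_def by (intro sum_mono card_image_le) simp
  finally show ?thesis by simp
qed

text \<open>After interchanging the sums, each coefficient multiplies a shifted sum of
  \<open>rep_count\<close>; replacing it by \<open>rep_sum A n\<close> costs at most
  \<open>i * count_upto A n\<close>.\<close>

lemma rep_sum_le:
  fixes A :: "nat set" and d :: nat and lam :: "nat \<Rightarrow> int"
  defines "D \<equiv> \<lambda>n. \<Sum>i=0..d. lam i * int (rep_count A (int n - int i))"
  shows "\<bar>\<Sum>i=0..d. lam i\<bar> * int (rep_sum A n)
    \<le> (\<Sum>k\<le>n. \<bar>D k\<bar>) + (\<Sum>i=0..d. \<bar>lam i\<bar> * int i) * int (count_upto A n)"
proof -
  let ?U = "\<lambda>i. \<Sum>k\<le>n. int (rep_count A (int k - int i))"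
  have "(\<Sum>k\<le>n. D k) = (\<Sum>i=0..d. lam i * ?U i)"
    unfolding D_def by (subst sum.swap) (simp add: sum_distrib_left)
  then have eq: "(\<Sum>i=0..d. lam i) * int (rep_sum A n)
      = (\<Sum>k\<le>n. D k) + (\<Sum>i=0..d. lam i * (int (rep_sum A n) - ?U i))"
    by (simp add: sum_distrib_right right_diff_distrib sum_subtractf)
  have "\<bar>\<Sum>i=0..d. lam i * (int (rep_sum A n) - ?U i)\<bar>
      \<le> (\<Sum>i=0..d. \<bar>lam i\<bar> * int (i * count_upto A n))" (is "\<bar>?E\<bar> \<le> _")
    by (rule order_trans[OF sum_abs])
      (intro sum_mono, simp only: abs_mult, intro mult_left_mono sum_rep_count_shift abs_ge_zero)
  also have "\<dots> = (\<Sum>i=0..d. \<bar>lam i\<bar> * int i) * int (count_upto A n)"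
    by (simp add: sum_distrib_right mult.assoc)
  finally have "\<bar>?E\<bar> \<le> \<dots>" .
  moreover have "\<bar>\<Sum>k\<le>n. D k\<bar> \<le> (\<Sum>k\<le>n. \<bar>D k\<bar>)" by (rule sum_abs)
  moreover have "\<bar>\<Sum>i=0..d. lam i\<bar> * int (rep_sum A n) = \<bar>(\<Sum>i=0..d. lam i) * int (rep_sum A n)\<bar>"
    by (simp add: abs_mult)
  ultimately show ?thesis
    unfolding eq by linarith
qed

lemma sum_le_of_eventually_le:
  fixes f :: "nat \<Rightarrow> real"
  assumes "\<forall>\<^sub>F n in sequentially. f n \<le> K"
  obtains C where "C \<ge> 0" "\<And>n. (\<Sum>k\<le>n. f k) \<le> C + K * (real n + 1)"
proof -
  from assms obtain N where N: "\<And>n. n \<ge> N \<Longrightarrow> f n \<le> K"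
    by (auto simp: eventually_sequentially)
  define C where "C = (\<Sum>k<N. \<bar>f k - K\<bar>)"
  have "(\<Sum>k\<le>n. f k) \<le> C + K * (real n + 1)" for n
  proof -
    \<comment> \<open>From \<open>N\<close> on the differences are at most 0, so only the finitely
      many earlier terms count, and \<open>C\<close> is independent of \<open>n\<close>.\<close>
    have "(\<Sum>k\<le>n. f k - K) \<le> (\<Sum>k\<le>n. if k < N then \<bar>f k - K\<bar> else 0)"
      using N by (intro sum_mono) (auto simp: not_less)
    also have "\<dots> = (\<Sum>k\<in>{..n} \<inter> {..<N}. \<bar>f k - K\<bar>)"
      by (simp add: sum.inter_restrict)
    also have "\<dots> \<le> C" unfolding C_def by (intro sum_mono2) auto
    finally show ?thesis by (simp add: sum_subtractf algebra_simps)
  qed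
  moreover have "C \<ge> 0" by (simp add: C_def sum_nonneg)
  ultimately show ?thesis using that by blast
qed

text \<open>The hypothesis is used twice: first with the trivial bound on \<open>a (2 * n)\<close>, to improve that
  bound to the order of the square root, and then with the improved bound.\<close>

lemma limsup_square_le:
  fixes a :: "nat \<Rightarrow> real"
  assumes s: "s \<ge> 1" and c: "c \<ge> 0" and C: "C \<ge> 0" and K: "K \<ge> 0"
    and a0: "\<And>n. 0 \<le> a n" and a1: "\<And>n. a n \<le> real n + 1"
    and a2: "\<And>n. s * (a n)\<^sup>2 \<le> C + K * (2 * real n + 1) + c * a (2 * n)"
  shows "limsup (\<lambda>n. ereal (s / 2 * (a n / sqrt (real n))\<^sup>2)) \<le> ereal K"
proof -
  \<comment> \<open>For \<open>n \<ge> 1\<close> both \<open>1 \<le> n\<close> and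
    \<open>2 * n + 1 \<le> 3 * n\<close> hold, which turns the affine bound into
    \<open>M * n\<close>.\<close>
  define M where "M = C + 3 * K + 3 * c"
  have M: "M \<ge> 0" using c C K by (simp add: M_def)
  have sq: "a n \<le> sqrt M * sqrt (real n)" if "n \<ge> 1" for n
  proof -
    have "(a n)\<^sup>2 \<le> s * (a n)\<^sup>2" using mult_right_mono[OF s, of "(a n)\<^sup>2"] by simp
    also have "\<dots> \<le> C + K * (2 * real n + 1) + c * (2 * real n + 1)"
      using a2[of n] mult_left_mono[OF a1[of "2 * n"] c] by simp
    also have "\<dots> \<le> C * real n + K * (3 * real n) + c * (3 * real n)"
      using that C K c by (intro add_mono mult_left_mono) (auto simp: mult_le_cancel_left1)
    finally have "(a n)\<^sup>2 \<le> M * real n" by (simp add: M_def algebra_simps)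
    then show ?thesis using a0[of n] by (simp add: real_le_rsqrt flip: real_sqrt_mult)
  qed
  define g where "g n = K + (C + K) / (2 * real n) + c * sqrt M * sqrt (2 * real n) / (2 * real n)"
    for n
  have "s / 2 * (a n / sqrt (real n))\<^sup>2 \<le> g n" if n: "n \<ge> 1" for n
  proof -
    have "s * (a n)\<^sup>2 \<le> C + K * (2 * real n + 1) + c * (sqrt M * sqrt (2 * real n))"
      using a2[of n] mult_left_mono[OF sq[of "2 * n"] c] n by simp
    then have "s * (a n)\<^sup>2 / (2 * real n)
        \<le> (C + K * (2 * real n + 1) + c * (sqrt M * sqrt (2 * real n))) / (2 * real n)"
      by (rule divide_right_mono) simp
    also have "\<dots> = g n" using n by (simp add: g_def field_simps)
    finally show ?thesis using n by (simp add: power_divide)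
  qed
  then have "limsup (\<lambda>n. ereal (s / 2 * (a n / sqrt (real n))\<^sup>2)) \<le> limsup (\<lambda>n. ereal (g n))"
    by (intro Limsup_mono eventually_sequentiallyI[of 1]) simp
  also have "\<dots> = ereal K"
  proof (rule lim_imp_Limsup)
    \<comment> \<open>The last term of \<open>g\<close> is of order \<open>1 / sqrt n\<close>; with
      only the trivial bound on \<open>a (2 * n)\<close> it would tend to \<open>c\<close>
      instead.\<close>
    have "g \<longlonglongrightarrow> K" unfolding g_def by real_asymp
    then show "(\<lambda>n. ereal (g n)) \<longlonglongrightarrow> ereal K" by simp
  qed simp
  finally show ?thesis .
qed

theorem theorem1:
  fixes A :: "nat set" and d :: nat and lam :: "nat \<Rightarrow> int"
  assumes "infinite A"
    and "(\<Sum>i=0..d. \<bar>lam i\<bar>) > 0"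
  shows "limsup (\<lambda>n::nat. ereal (real_of_int
             \<bar>\<Sum>i=0..d. lam i * int (rep_count A (int n - int i))\<bar>))
       \<ge> limsup (\<lambda>n::nat. ereal (real_of_int \<bar>\<Sum>i=0..d. lam i\<bar> / (2 * (real d + 1)\<^sup>2)
             * (real (B_count A d lam n) / sqrt (real n))\<^sup>2))"
proof (rule dense_ge)
  define D where "D n = \<bar>\<Sum>i=0..d. lam i * int (rep_count A (int n - int i))\<bar>" for n
  define s where "s = \<bar>\<Sum>i=0..d. lam i\<bar>"
  \<comment> \<open>Bounding by every \<open>x\<close> strictly above the limsup of \<open>D\<close>
    gives a genuine eventual bound, with no epsilon to carry along.\<close>
  fix x :: ereal
  assume "limsup (\<lambda>n::nat. ereal (real_of_int
             \<bar>\<Sum>i=0..d. lam i * int (rep_count A (int n - int i))\<bar>)) < x"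
  then have "limsup (\<lambda>n. ereal (D n)) < x" by (simp add: D_def)
  then have ev: "\<forall>\<^sub>F n in sequentially. ereal (D n) < x" by (rule Limsup_lessD)
  have "limsup (\<lambda>n. ereal (s / (2 * (real d + 1)\<^sup>2) * (B_count A d lam n / sqrt (real n))\<^sup>2)) \<le> x"
  proof (cases x)
    case PInf
    then show ?thesis by simp
  next
    case MInf
    with ev show ?thesis by simp
  next
    case (real K)
    with ev have ev: "\<forall>\<^sub>F n in sequentially. real_of_int (D n) \<le> K"
      by (auto elim!: eventually_mono)
    then obtain n where "real_of_int (D n) \<le> K"
      by (auto simp: eventually_sequentially)
    moreover have "real_of_int (D n) \<ge> 0" by (simp add: D_def)
    ultimately have K: "K \<ge> 0" by linarith
    from ev obtain C where C: "C \<ge> 0" "\<And>n. (\<Sum>k\<le>n. real_of_int (D k)) \<le> C + K * (real n + 1)"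
      by (rule sum_le_of_eventually_le) blast
    define c where "c = (\<Sum>i=0..d. \<bar>lam i\<bar> * int i)"
    have "limsup (\<lambda>n. ereal (s / (2 * (real d + 1)\<^sup>2) * (B_count A d lam n / sqrt (real n))\<^sup>2))
        \<le> limsup (\<lambda>n. ereal (s / 2 * (count_upto A n / sqrt (real n))\<^sup>2))"
    proof (intro Limsup_mono always_eventually allI)
      fix n
      have "real (B_count A d lam n) \<le> (real d + 1) * count_upto A n"
        using of_nat_mono[OF B_count_le[of A d lam n], where 'a = real] by (simp add: algebra_simps)
      then have "(B_count A d lam n / sqrt (real n))\<^sup>2
          \<le> ((real d + 1) * count_upto A n / sqrt (real n))\<^sup>2"
        by (intro power_mono divide_right_mono) auto
      \<comment> \<open>The factor \<open>(d + 1)\<^sup>2\<close> in the denominator exactly absorbs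
        the loss from \<open>B_count_le\<close>.\<close>
      then have "s / (2 * (real d + 1)\<^sup>2) * (B_count A d lam n / sqrt (real n))\<^sup>2
          \<le> s / (2 * (real d + 1)\<^sup>2) * ((real d + 1) * count_upto A n / sqrt (real n))\<^sup>2"
        by (intro mult_left_mono) (auto simp: s_def)
      also have "\<dots> = s / 2 * (count_upto A n / sqrt (real n))\<^sup>2"
        by (simp add: power_divide power_mult_distrib)
      finally show "ereal (s / (2 * (real d + 1)\<^sup>2) * (B_count A d lam n / sqrt (real n))\<^sup>2)
          \<le> ereal (s / 2 * (count_upto A n / sqrt (real n))\<^sup>2)" by simp
    qed
    also have "\<dots> \<le> ereal K"
    \<comment> \<open>If the coefficients sum to 0, the bounded sequence is identically 0. Otherwise
      \<open>s \<ge> 1\<close> because \<open>s\<close> is a nonnegative integer.\<close>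
    proof (cases "s = 0")
      case True
      with K show ?thesis by (simp add: Limsup_const)
    next
      case False
      show ?thesis
      proof (rule limsup_square_le)
        show "real_of_int s \<ge> 1" using False unfolding s_def by linarith
        show "real_of_int c \<ge> 0" by (simp add: c_def sum_nonneg)
        show "real (count_upto A n) \<le> real n + 1" for n
          using of_nat_mono[OF count_upto_le[of A n], where 'a = real] by simp
        show "s * (real (count_upto A n))\<^sup>2
            \<le> C + K * (2 * real n + 1) + c * real (count_upto A (2 * n))" for n
        proof -
          have "s * int ((count_upto A n)\<^sup>2) \<le> s * int (rep_sum A (2 * n))"
            by (intro mult_left_mono of_nat_mono count_upto_square_le) (simp add: s_def)
          also have "\<dots> \<le> (\<Sum>k\<le>2 * n. D k) + c * int (count_upto A (2 * n))"
            unfolding s_def c_def D_def by (rule rep_sum_le)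
          finally have "real_of_int (s * int ((count_upto A n)\<^sup>2))
              \<le> real_of_int ((\<Sum>k\<le>2 * n. D k) + c * int (count_upto A (2 * n)))"
            by (simp only: of_int_le_iff)
          with C(2)[of "2 * n"] show ?thesis by simp
        qed
      qed (use K C in auto)
    qed
    finally show ?thesis by (simp add: real)
  qed
  then show "limsup (\<lambda>n. ereal (real_of_int \<bar>\<Sum>i=0..d. lam i\<bar> / (2 * (real d + 1)\<^sup>2)
             * (real (B_count A d lam n) / sqrt (real n))\<^sup>2)) \<le> x"
    by (simp add: s_def)
qed

end
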